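(* Let $\varphi_e$ and $\varphi_{e_1}$ be two ruled surfaces in $\mathbb{R}^3$ that form a Bertrand surface offset, with offset angle $\theta$ and offset distance $\theta^*$, and let $\varphi_e$ be developable. Then $\varphi_{e_1}$ is developable if and only if $$\left(\int_0^{s}\gamma^*\,ds\right)\sin\theta+\theta^*\left[\left(\int_0^{s}\gamma\,ds\right)\cos\theta-s\sin\theta\right]=0$$ holds (for all $s$).
   Context: Dual numbers are $\bar a=a+\varepsilon a^*$ with $a,a^*\in\mathbb{R}$, $\varepsilon\neq 0$, $\varepsilon^2=0$. For a differentiable real function $f$, $f(x+\varepsilon x^* )=f(x)+\varepsilon x^*f'(x)$; e.g. $\cos(x+\varepsilon x^* )=\cos x-\varepsilon x^*\sin x$, $\sin(x+\varepsilon x^* )=\sin x+\varepsilon x^*\cos x$. Dual vectors are $\tilde a=\vec a+\varepsilon\vec a^*$ with $\vec a,\vec a^*\in\mathbb{R}^3$; scalar and vector products are extended $\varepsilon$-bilinearly. A ruled surface $\varphi_e=\vec c(s)+v\,\vec e(s)$ (all data smooth) is parametrized so that $\langle \vec e,\vec e\rangle=1$, $\langle \vec e',\vec e'\rangle=1$, $\langle \vec c',\vec e'\rangle=0$, where prime is $d/ds$; so $s$ is the arc length of the real indicatrix $\vec e(s)$ and $\vec c$ is the striction line. It is represented by the dual unit vector $\tilde e=\vec e+\varepsilon\,\vec c\times\vec e$. Put $\vec t=\vec e'$, $\vec g=\vec e\times\vec t$; the conical curvature $\gamma$ is defined by $\vec e'=\vec t$, $\vec t'=\gamma\vec g-\vec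 e$, $\vec g'=-\gamma\vec t$. Put $\Delta=\det(\vec c',\vec e,\vec t)$, $\delta=\langle\vec c',\vec e\rangle$. The surface $\varphi_e$ is developable if and only if $\Delta=0$ identically. The dual Darboux frame is $\{\tilde e,\tilde t,\tilde g\}$ with $\tilde t=\vec t+\varepsilon\,\vec c\times\vec t$, $\tilde g=\vec g+\varepsilon\,\vec c\times\vec g$. The dual conical curvature is $\bar\gamma=\gamma+\varepsilon\gamma^*$ with $\gamma^*=\delta-\gamma\Delta$. The corresponding objects of a second ruled surface $\varphi_{e_1}$ (with its own parameter $s_1$, derivatives taken with respect to $s_1$) carry the subscript $1$. $\varphi_e$ and $\varphi_{e_1}$ form a Bertrand surface offset if, under a correspondence $s_1=s_1(s)$ between their rulings (differentiable with nonvanishing derivative), $\tilde t=\tilde t_1$ at corresponding parameters. The frames are then related by $\tilde e_1=\cos\bar\theta\,\tilde e-\sin\bar\theta\,\tilde g$, $\tilde t_1=\tilde t$, $\tilde g_1=\sin\bar\theta\,\tilde e+\cos\bar\theta\,\tilde g$, where $\bar\theta=\theta+\varepsilon\theta^*$ ($0\le\theta\le\pi$, $\theta^*\in\mathbb{R}$) is the dual angle between $\tilde e$ and $\tilde e_1$; $\theta$ is the offset angle and $\theta^*$ the offset distance. *)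

theory Defs
  imports "HOL-Analysis.Analysis"
begin

unbundle cross3_syntax

section \<open>Dual numbers and dual vectors\<close>

text \<open>A pair \<open>(a, a')\<close> stands for \<open>a + \<epsilon> a'\<close> with \<open>\<epsilon>\<^sup>2 = 0\<close>; addition and subtraction are the
  componentwise operations of the library's product instances.\<close>

type_synonym dual = "real \<times> real"
type_synonym dual_vec = "(real^3) \<times> (real^3)"

definition dual_scale :: "dual \<Rightarrow> dual_vec \<Rightarrow> dual_vec"  (infixr \<open>*\<^sub>D\<close> 75)
  where "a *\<^sub>D x = (fst a *\<^sub>R fst x, fst a *\<^sub>R snd x + snd a *\<^sub>R fst x)"

definition dual_ext :: "(real \<Rightarrow> real) \<Rightarrow> dual \<Rightarrow> dual"
  where "dual_ext f x = (f (fst x), snd x * deriv f (fst x))"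

abbreviation dual_cos :: "dual \<Rightarrow> dual" where "dual_cos \<equiv> dual_ext cos"
abbreviation dual_sin :: "dual \<Rightarrow> dual" where "dual_sin \<equiv> dual_ext sin"

lemma dual_cos_eq: "dual_cos (x, x') = (cos x, - x' * sin x)"
proof -
  have "deriv cos x = - sin x" by (rule DERIV_imp_deriv) (auto intro!: derivative_eq_intros)
  then show ?thesis by (simp add: dual_ext_def)
qed

lemma dual_sin_eq: "dual_sin (x, x') = (sin x, x' * cos x)"
proof -
  have "deriv sin x = cos x" by (rule DERIV_imp_deriv) (auto intro!: derivative_eq_intros)
  then show ?thesis by (simp add: dual_ext_def)
qed

section \<open>Ruled surfaces\<close>

text \<open>The surface \<open>\<phi>(s,v) = c(s) + v e(s)\<close> is given by its parameter interval, its striction line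
  \<open>c\<close> and its unit director \<open>e\<close>. The interval need not be open: all derivatives are taken within
  it, hence are one-sided at an end point that belongs to it.\<close>

record ruled_surface =
  param_dom :: "real set"
  striction :: "real \<Rightarrow> real^3"
  director :: "real \<Rightarrow> real^3"

abbreviation curve_deriv :: "real set \<Rightarrow> (real \<Rightarrow> real^3) \<Rightarrow> real \<Rightarrow> real^3"
  where "curve_deriv I f \<equiv> (\<lambda>s. vector_derivative f (at s within I))"

definition smooth_curve_on :: "real set \<Rightarrow> (real \<Rightarrow> real^3) \<Rightarrow> bool"
  where "smooth_curve_on I f \<longleftrightarrow> (\<forall>n. ((curve_deriv I ^^ n) f) differentiable_on I)"

definition surf_deriv :: "ruled_surface \<Rightarrow> (real \<Rightarrow> real^3) \<Rightarrow> real \<Rightarrow> real^3"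
  where "surf_deriv \<phi> f = curve_deriv (param_dom \<phi>) f"

definition is_ruled_surface :: "ruled_surface \<Rightarrow> bool"
  where "is_ruled_surface \<phi> \<longleftrightarrow>
    is_interval (param_dom \<phi>) \<and> interior (param_dom \<phi>) \<noteq> {} \<and>
    smooth_curve_on (param_dom \<phi>) (striction \<phi>) \<and>
    smooth_curve_on (param_dom \<phi>) (director \<phi>) \<and>
    (\<forall>s\<in>param_dom \<phi>.
       director \<phi> s \<bullet> director \<phi> s = 1 \<and>
       surf_deriv \<phi> (director \<phi>) s \<bullet> surf_deriv \<phi> (director \<phi>) s = 1 \<and>
       surf_deriv \<phi> (striction \<phi>) s \<bullet> surf_deriv \<phi> (director \<phi>) s = 0)"

definition frame_t :: "ruled_surface \<Rightarrow> real \<Rightarrow> real^3"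
  where "frame_t \<phi> = surf_deriv \<phi> (director \<phi>)"

definition frame_g :: "ruled_surface \<Rightarrow> real \<Rightarrow> real^3"
  where "frame_g \<phi> s = director \<phi> s \<times> frame_t \<phi> s"

text \<open>The conical curvature is the coefficient \<open>\<gamma>\<close> in the equations \<open>t' = \<gamma> g - e\<close>,
  \<open>g' = - \<gamma> t\<close>; it exists and is unique on a ruled surface, see \<open>darboux_equations\<close> below.\<close>

definition conical_curvature :: "ruled_surface \<Rightarrow> real \<Rightarrow> real"
  where "conical_curvature \<phi> s =
    (THE k. surf_deriv \<phi> (frame_t \<phi>) s = k *\<^sub>R frame_g \<phi> s - director \<phi> s \<and>
            surf_deriv \<phi> (frame_g \<phi>) s = - k *\<^sub>R frame_t \<phi> s)"

definition Delta_inv :: "ruled_surface \<Rightarrow> real \<Rightarrow> real"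
  where "Delta_inv \<phi> s =
    det (vector [surf_deriv \<phi> (striction \<phi>) s, director \<phi> s, frame_t \<phi> s] :: real^3^3)"

definition delta_inv :: "ruled_surface \<Rightarrow> real \<Rightarrow> real"
  where "delta_inv \<phi> s = surf_deriv \<phi> (striction \<phi>) s \<bullet> director \<phi> s"

definition dual_conical_curvature :: "ruled_surface \<Rightarrow> real \<Rightarrow> dual"
  where "dual_conical_curvature \<phi> s =
    (conical_curvature \<phi> s, delta_inv \<phi> s - conical_curvature \<phi> s * Delta_inv \<phi> s)"

definition conical_curvature_star :: "ruled_surface \<Rightarrow> real \<Rightarrow> real"
  where "conical_curvature_star \<phi> s = snd (dual_conical_curvature \<phi> s)"

text \<open>That this is developability in the sense of tangent planes that are constant along each
  ruling is \<open>developable_iff_normals_parallel\<close> below.\<close>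

definition developable :: "ruled_surface \<Rightarrow> bool"
  where "developable \<phi> \<longleftrightarrow> (\<forall>s\<in>param_dom \<phi>. Delta_inv \<phi> s = 0)"

section \<open>Dual Darboux frame and Bertrand offsets\<close>

definition dual_e :: "ruled_surface \<Rightarrow> real \<Rightarrow> dual_vec"
  where "dual_e \<phi> s = (director \<phi> s, striction \<phi> s \<times> director \<phi> s)"

definition dual_t :: "ruled_surface \<Rightarrow> real \<Rightarrow> dual_vec"
  where "dual_t \<phi> s = (frame_t \<phi> s, striction \<phi> s \<times> frame_t \<phi> s)"

definition dual_g :: "ruled_surface \<Rightarrow> real \<Rightarrow> dual_vec"
  where "dual_g \<phi> s = (frame_g \<phi> s, striction \<phi> s \<times> frame_g \<phi> s)"

text \<open>\<open>\<sigma>\<close> is the correspondence \<open>s \<mapsto> s\<^sub>1(s)\<close> between the rulings of \<open>\<phi>\<close> and those of \<open>\<phi>\<^sub>1\<close>.\<close>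

definition bertrand_offset :: "ruled_surface \<Rightarrow> ruled_surface \<Rightarrow> (real \<Rightarrow> real) \<Rightarrow> bool"
  where "bertrand_offset \<phi> \<phi>\<^sub>1 \<sigma> \<longleftrightarrow>
    bij_betw \<sigma> (param_dom \<phi>) (param_dom \<phi>\<^sub>1) \<and>
    (\<forall>s\<in>param_dom \<phi>.
       (\<exists>d. d \<noteq> 0 \<and> (\<sigma> has_real_derivative d) (at s within param_dom \<phi>)) \<and>
       dual_t \<phi>\<^sub>1 (\<sigma> s) = dual_t \<phi> s)"

text \<open>The dual angle \<open>\<theta> + \<epsilon> \<theta>'\<close> between corresponding rulings of a Bertrand offset is the one that
  relates the two frames; together with \<open>0 \<le> \<theta> \<le> \<pi>\<close> this determines it. It is a function of
  \<open>s\<close> here: its constancy is a consequence of the offset condition, not part of the definition.\<close>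

definition is_offset_angle ::
    "ruled_surface \<Rightarrow> ruled_surface \<Rightarrow> (real \<Rightarrow> real) \<Rightarrow> (real \<Rightarrow> real) \<Rightarrow> (real \<Rightarrow> real) \<Rightarrow> bool"
  where "is_offset_angle \<phi> \<phi>\<^sub>1 \<sigma> \<theta> \<theta>' \<longleftrightarrow>
    (\<forall>s\<in>param_dom \<phi>.
       0 \<le> \<theta> s \<and> \<theta> s \<le> pi \<and>
       dual_e \<phi>\<^sub>1 (\<sigma> s) =
         dual_cos (\<theta> s, \<theta>' s) *\<^sub>D dual_e \<phi> s - dual_sin (\<theta> s, \<theta>' s) *\<^sub>D dual_g \<phi> s \<and>
       dual_g \<phi>\<^sub>1 (\<sigma> s) =
         dual_sin (\<theta> s, \<theta>' s) *\<^sub>D dual_e \<phi> s + dual_cos (\<theta> s, \<theta>' s) *\<^sub>D dual_g \<phi> s)"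

section \<open>Consistency of the definitions\<close>

lemma param_dom_not_bot:
  assumes "is_ruled_surface \<phi>" "s \<in> param_dom \<phi>"
  shows "at s within param_dom \<phi> \<noteq> bot"
proof -
  let ?I = "param_dom \<phi>"
  have I: "is_interval ?I" "interior ?I \<noteq> {}" using assms by (auto simp: is_ruled_surface_def)
  have "connected ?I" using I(1) is_interval_connected by blast
  moreover have "\<nexists>a. ?I = {a}" using I(2) by auto
  ultimately have "s islimpt ?I" using connected_imp_perfect[of ?I s] assms(2) by auto
  then show ?thesis by (simp add: trivial_limit_within)
qed

lemma frame_orthonormal:
  assumes "is_ruled_surface \<phi>" "s \<in> param_dom \<phi>"
  shows "director \<phi> s \<bullet> director \<phi> s = 1" "frame_t \<phi> s \<bullet> frame_t \<phi> s = 1"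
    "director \<phi> s \<bullet> frame_t \<phi> s = 0"
proof -
  let ?I = "param_dom \<phi>" and ?e = "director \<phi>" and ?t = "frame_t \<phi>"
  have ee: "?e u \<bullet> ?e u = 1" if "u \<in> ?I" for u using assms(1) that by (auto simp: is_ruled_surface_def)
  show "?e s \<bullet> ?e s = 1" "?t s \<bullet> ?t s = 1"
    using assms by (auto simp: is_ruled_surface_def frame_t_def)
  have "?e differentiable_on ?I"
    using assms(1) unfolding is_ruled_surface_def smooth_curve_on_def
    by (metis funpow_0)
  then have D: "(?e has_vector_derivative ?t s) (at s within ?I)"
    using assms(2) by (simp add: differentiable_on_def vector_derivative_works frame_t_def surf_deriv_def)
  have "((\<lambda>u. ?e u \<bullet> ?e u) has_vector_derivative (?e s \<bullet> ?t s + ?t s \<bullet> ?e s)) (at s within ?I)"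
    using bounded_bilinear.has_vector_derivative[OF bounded_bilinear_inner D D] .
  moreover have "((\<lambda>u. ?e u \<bullet> ?e u) has_vector_derivative 0) (at s within ?I)"
    by (rule has_vector_derivative_transform[of s ?I _ "\<lambda>_. 1"])
       (use assms(2) ee in \<open>auto\<close>)
  ultimately have "?e s \<bullet> ?t s + ?t s \<bullet> ?e s = 0"
    using vector_derivative_unique_within[OF param_dom_not_bot[OF assms]] by blast
  then show "?e s \<bullet> ?t s = 0" by (simp add: inner_commute)
qed

lemma orthonormal_expansion:
  fixes e t x :: "real^3"
  assumes "e \<bullet> e = 1" "t \<bullet> t = 1" "e \<bullet> t = 0"
  shows "x = (x \<bullet> e) *\<^sub>R e + (x \<bullet> t) *\<^sub>R t + (x \<bullet> (e \<times> t)) *\<^sub>R (e \<times> t)"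
    and "(e \<times> t) \<bullet> (e \<times> t) = 1" and "(e \<times> t) \<times> e = t" and "t \<times> (e \<times> t) = e"
proof -
  have lag: "(a \<times> b) \<times> c = (a \<bullet> c) *\<^sub>R b - (b \<bullet> c) *\<^sub>R a" for a b c :: "real^3"
    by (simp add: cross3_simps vec_eq_iff forall_3)
  show gg: "(e \<times> t) \<bullet> (e \<times> t) = 1"
    using norm_cross_dot[of e t] assms by (simp add: power2_norm_eq_inner power_mult_distrib)
  show ge: "(e \<times> t) \<times> e = t" by (simp add: lag assms inner_commute)
  have "(e \<times> t) \<times> t = - e" using assms by (simp add: lag inner_commute)
  then show tg: "t \<times> (e \<times> t) = e" by (metis cross_skew minus_minus)
  define g where "g = e \<times> t"
  define y where "y = x - ((x \<bullet> e) *\<^sub>R e + (x \<bullet> t) *\<^sub>R t + (x \<bullet> g) *\<^sub>R g)"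
  have z: "e \<bullet> g = 0" "t \<bullet> g = 0" "g \<bullet> g = 1" by (simp_all add: g_def dot_cross_self gg)
  have z': "t \<bullet> e = 0" "g \<bullet> e = 0" "g \<bullet> t = 0" using z assms(3) by (simp_all add: inner_commute)
  have y0: "y \<bullet> e = 0" "y \<bullet> t = 0" "y \<bullet> g = 0"
    using assms z z' by (simp_all add: y_def inner_diff_left inner_add_left)
  have "g \<times> y = 0" using y0 by (simp add: g_def lag inner_commute)
  moreover have "g \<bullet> y = 0" using y0 by (simp add: inner_commute)
  ultimately have "y = 0" using z(3) norm_and_cross_eq_0[of g y] by auto
  then show "x = (x \<bullet> e) *\<^sub>R e + (x \<bullet> t) *\<^sub>R t + (x \<bullet> (e \<times> t)) *\<^sub>R (e \<times> t)"
    by (simp add: y_def g_def)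
qed

lemma bounded_bilinear_cross3: "bounded_bilinear (\<times>)"
  using bilinear_cross bilinear_conv_bounded_bilinear by blast

lemma darboux_equations:
  assumes "is_ruled_surface \<phi>" "s \<in> param_dom \<phi>"
  shows "surf_deriv \<phi> (frame_t \<phi>) s = conical_curvature \<phi> s *\<^sub>R frame_g \<phi> s - director \<phi> s"
    and "surf_deriv \<phi> (frame_g \<phi>) s = - conical_curvature \<phi> s *\<^sub>R frame_t \<phi> s"
    and "conical_curvature \<phi> s = surf_deriv \<phi> (frame_t \<phi>) s \<bullet> frame_g \<phi> s"
proof -
  let ?I = "param_dom \<phi>" and ?e = "director \<phi>" and ?t = "frame_t \<phi>" and ?g = "frame_g \<phi>"
  let ?t' = "surf_deriv \<phi> ?t s"
  note on = frame_orthonormal[OF assms(1)]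
  note nb = param_dom_not_bot[OF assms]
  have sm: "((curve_deriv ?I ^^ n) ?e) differentiable_on ?I" for n
    using assms(1) unfolding is_ruled_surface_def smooth_curve_on_def by blast
  have "?e differentiable_on ?I" using sm[of 0] by simp
  then have De: "(?e has_vector_derivative ?t s) (at s within ?I)"
    using assms(2) by (simp add: differentiable_on_def vector_derivative_works frame_t_def surf_deriv_def)
  have "?t differentiable_on ?I" using sm[of 1] by (simp add: frame_t_def surf_deriv_def)
  then have Dt: "(?t has_vector_derivative ?t') (at s within ?I)"
    using assms(2) by (simp add: differentiable_on_def vector_derivative_works surf_deriv_def)
  have "((\<lambda>u. ?t u \<bullet> ?t u) has_vector_derivative (?t s \<bullet> ?t' + ?t' \<bullet> ?t s)) (at s within ?I)"
    using bounded_bilinear.has_vector_derivative[OF bounded_bilinear_inner Dt Dt] .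
  moreover have "((\<lambda>u. ?t u \<bullet> ?t u) has_vector_derivative 0) (at s within ?I)"
    by (rule has_vector_derivative_transform[of s ?I _ "\<lambda>_. 1"]) (use assms(2) on in \<open>auto\<close>)
  ultimately have tt: "?t' \<bullet> ?t s = 0"
    using vector_derivative_unique_within[OF nb] by (fastforce simp: inner_commute)
  have "((\<lambda>u. ?e u \<bullet> ?t u) has_vector_derivative (?e s \<bullet> ?t' + ?t s \<bullet> ?t s)) (at s within ?I)"
    using bounded_bilinear.has_vector_derivative[OF bounded_bilinear_inner De Dt] .
  moreover have "((\<lambda>u. ?e u \<bullet> ?t u) has_vector_derivative 0) (at s within ?I)"
    by (rule has_vector_derivative_transform[of s ?I _ "\<lambda>_. 0"]) (use assms(2) on in \<open>auto\<close>)
  ultimately have "?e s \<bullet> ?t' + ?t s \<bullet> ?t s = 0"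
    using vector_derivative_unique_within[OF nb] by blast
  then have te: "?t' \<bullet> ?e s = - 1" using on(2)[OF assms(2)] by (simp add: inner_commute)
  define k where "k = ?t' \<bullet> ?g s"
  note ox = orthonormal_expansion[OF on(1)[OF assms(2)] on(2)[OF assms(2)] on(3)[OF assms(2)]]
  have A: "?t' = k *\<^sub>R ?g s - ?e s"
    using ox(1)[of ?t'] te tt by (simp add: k_def frame_g_def)
  have "(?g has_vector_derivative (?e s \<times> ?t' + ?t s \<times> ?t s)) (at s within ?I)"
    using bounded_bilinear.has_vector_derivative[OF bounded_bilinear_cross3 De Dt]
    by (simp add: frame_g_def[abs_def])
  then have "surf_deriv \<phi> ?g s = ?e s \<times> ?t' + ?t s \<times> ?t s"
    using vector_derivative_within[OF nb] by (simp add: surf_deriv_def)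
  also have "\<dots> = k *\<^sub>R (?e s \<times> ?g s)"
    by (simp add: A Cross3.right_diff_distrib cross_mult_right)
  also have "?e s \<times> ?g s = - ?t s" using ox(3) by (metis cross_skew frame_g_def)
  finally have B: "surf_deriv \<phi> ?g s = - k *\<^sub>R ?t s" by simp
  have t0: "?t s \<noteq> 0" using on(2)[OF assms(2)] by auto
  have K: "conical_curvature \<phi> s = k"
    unfolding conical_curvature_def
    by (rule the_equality) (use A B t0 in \<open>auto\<close>)
  show "?t' = conical_curvature \<phi> s *\<^sub>R ?g s - ?e s" using A K by simp
  show "surf_deriv \<phi> ?g s = - conical_curvature \<phi> s *\<^sub>R ?t s" using B K by simp
  show "conical_curvature \<phi> s = ?t' \<bullet> ?g s" using K k_def by simp
qed

text \<open>The normal at \<open>c(s) + v e(s)\<close> is the cross product of the two partial derivatives.\<close>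

definition surface_normal :: "ruled_surface \<Rightarrow> real \<Rightarrow> real \<Rightarrow> real^3"
  where "surface_normal \<phi> s v =
    (surf_deriv \<phi> (striction \<phi>) s + v *\<^sub>R surf_deriv \<phi> (director \<phi>) s) \<times> director \<phi> s"

lemma developable_iff_normals_parallel:
  assumes "is_ruled_surface \<phi>"
  shows "developable \<phi> \<longleftrightarrow>
    (\<forall>s\<in>param_dom \<phi>. \<forall>v w. surface_normal \<phi> s v \<times> surface_normal \<phi> s w = 0)"
proof -
  have "(\<forall>v w. surface_normal \<phi> s v \<times> surface_normal \<phi> s w = 0) \<longleftrightarrow> Delta_inv \<phi> s = 0"
    if s: "s \<in> param_dom \<phi>" for s
  proof -
    let ?e = "director \<phi> s" and ?t = "frame_t \<phi> s" and ?c' = "surf_deriv \<phi> (striction \<phi>) s"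
    note on = frame_orthonormal[OF assms s]
    note ox = orthonormal_expansion[OF on]
    define g where "g = ?e \<times> ?t"
    define D where "D = Delta_inv \<phi> s"
    have "?c' \<bullet> ?t = 0" using assms s by (simp add: is_ruled_surface_def frame_t_def)
    moreover have "?c' \<bullet> g = D" by (simp add: g_def D_def Delta_inv_def dot_cross_det)
    ultimately have c: "?c' = (?c' \<bullet> ?e) *\<^sub>R ?e + D *\<^sub>R g" using ox(1)[of ?c'] by (simp add: g_def)
    have ge: "g \<times> ?e = ?t" using ox(3) by (simp add: g_def)
    have te: "?t \<times> ?e = - g" by (metis cross_skew g_def)
    have tg: "?t \<times> g = ?e" using ox(4) by (simp add: g_def)
    have gt: "g \<times> ?t = - ?e" using tg by (metis cross_skew)
    have N: "surface_normal \<phi> s v = D *\<^sub>R ?t - v *\<^sub>R g" for v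
    proof -
      have "surface_normal \<phi> s v = (((?c' \<bullet> ?e) *\<^sub>R ?e + D *\<^sub>R g) + v *\<^sub>R ?t) \<times> ?e"
        using c by (simp add: surface_normal_def frame_t_def)
      also have "\<dots> = D *\<^sub>R ?t - v *\<^sub>R g"
        by (simp add: cross_add_left cross_mult_left ge te)
      finally show ?thesis .
    qed
    have "surface_normal \<phi> s v \<times> surface_normal \<phi> s w = (D * (v - w)) *\<^sub>R ?e" for v w
      by (simp add: N Cross3.left_diff_distrib Cross3.right_diff_distrib cross_mult_left cross_mult_right tg gt
          algebra_simps)
    moreover have "?e \<noteq> 0" using on(1) by auto
    ultimately show ?thesis by (auto simp: D_def)
  qed
  then show ?thesis by (auto simp: developable_def)
qed

end

theory Submission
  imports Defs
begin

text \<open>At corresponding parameters the two surfaces share the central normal \<open>t\<close>. The real part of the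
  frame relation gives \<open>e\<^sub>1 = cos \<theta> e - sin \<theta> g\<close>, and its dual part says that the striction
  points are displaced along \<open>t\<close> by the offset distance, \<open>c\<^sub>1 = c + \<theta>' t\<close>. Since
  \<open>cos \<theta> = e\<^sub>1 \<bullet> e\<close> and \<open>\<theta>' = (c\<^sub>1 - c) \<bullet> t\<close>, differentiation shows that both
  \<open>\<theta>\<close> and \<open>\<theta>'\<close> are constant: every term of either derivative is an inner product that
  vanishes by orthonormality of a frame or by the striction condition \<open>c' \<bullet> e' = 0\<close>.

  Differentiating \<open>c\<^sub>1 = c + \<theta>' t\<close> once more and taking the component along \<open>g\<^sub>1\<close> gives
  \<open>(ds\<^sub>1/ds) \<Delta>\<^sub>1 = \<delta> sin \<theta> + \<Delta> cos \<theta> + \<theta>' (\<gamma> cos \<theta> - sin \<theta>)\<close>. For a developable first surface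
  \<open>\<Delta> = 0\<close> and \<open>\<delta> = \<gamma>\<^sup>*\<close>, so the right-hand side is exactly the integrand whose integral from
  \<open>0\<close> to \<open>s\<close> is the expression in the theorem. As \<open>ds\<^sub>1/ds\<close> has no zero and the integrand is
  continuous, \<open>\<Delta>\<^sub>1\<close> vanishes identically iff all these integrals do.\<close>

section \<open>Vanishing of all integrals of a continuous function\<close>

text \<open>By the fundamental theorem of calculus \<open>h\<close> is the derivative of its integral. The interval
  may contain its end points, so the derivative is taken within a compact subinterval that contains
  both \<open>0\<close> and \<open>s\<close>.\<close>

lemma interval_integral_zero_iff:
  fixes h :: "real \<Rightarrow> real"
  assumes I: "is_interval I" "interior I \<noteq> {}" "0 \<in> I" and cont: "continuous_on I h"
  shows "(\<forall>s\<in>I. (LBINT u=0..s. h u) = 0) \<longleftrightarrow> (\<forall>s\<in>I. h s = 0)"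
proof
  assume L: "\<forall>s\<in>I. (LBINT u=0..s. h u) = 0"
  show "\<forall>s\<in>I. h s = 0"
  proof
    fix s assume s: "s \<in> I"
    \<comment> \<open>A second point keeps the interval around \<open>0\<close> and \<open>s\<close> nondegenerate when \<open>s = 0\<close>.\<close>
    obtain r where r: "r \<in> I" "r \<noteq> 0"
    proof -
      have "I \<noteq> {0}" using I(2) by auto
      then show ?thesis using that I(3) by auto
    qed
    define a where "a = min 0 (min s r)"
    define b where "b = max 0 (max s r)"
    have ab: "a < b" "a \<le> 0" "0 \<le> b" "a \<le> s" "s \<le> b" "a \<in> I" "b \<in> I"
      using r s I(3) by (auto simp: a_def b_def min_def max_def)
    have sub: "{a..b} \<subseteq> I"
      using mem_is_interval_1_I[OF I(1) ab(6,7)] by auto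
    have D: "((\<lambda>u. LBINT y=(0::real)..u. h y) has_vector_derivative h s) (at s within {a..b})"
      using interval_integral_FTC2[OF ab(2,3) continuous_on_subset[OF cont sub] ab(4,5)] .
    have D0: "((\<lambda>u. LBINT y=(0::real)..u. h y) has_vector_derivative 0) (at s within {a..b})"
      by (rule has_vector_derivative_transform[of s "{a..b}" _ "\<lambda>_. 0"])
         (use L sub ab in \<open>auto simp: zero_ereal_def\<close>)
    show "h s = 0"
      using vector_derivative_unique_within[OF _ D D0] ab by (simp add: trivial_limit_within)
  qed
next
  assume h: "\<forall>s\<in>I. h s = 0"
  show "\<forall>s\<in>I. (LBINT u=0..s. h u) = 0"
  proof
    fix s assume s: "s \<in> I"
    have "(LBINT u=(0::real)..s. h u) = (LBINT u=(0::real)..s. 0)"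
    proof (rule interval_integral_cong)
      fix u assume "u \<in> einterval (min (ereal 0) (ereal s)) (max (ereal 0) (ereal s))"
      then have "min 0 s \<le> u" "u \<le> max 0 s" by (auto simp: einterval_iff min_def max_def split: if_splits)
      moreover have "min 0 s \<in> I" "max 0 s \<in> I" using s I(3) by (simp_all add: min_def max_def)
      ultimately have "u \<in> I" using mem_is_interval_1_I[OF I(1)] by blast
      then show "h u = 0" using h by blast
    qed
    then show "(LBINT u=0..s. h u) = 0" by (simp add: zero_ereal_def)
  qed
qed

lemma interval_integrable_continuous_from_zero:
  fixes h :: "real \<Rightarrow> real"
  assumes I: "is_interval I" "0 \<in> I" "s \<in> I" and cont: "continuous_on I h"
  shows "interval_lebesgue_integrable lborel 0 s h"
proof -
  have sub: "{min 0 s..max 0 s} \<subseteq> I"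
    using I mem_is_interval_1_I[OF I(1), of "min 0 s" "max 0 s"] by (auto simp: min_def max_def)
  have "set_integrable lborel {min 0 s..max 0 s} h"
    by (rule borel_integrable_atLeastAtMost') (rule continuous_on_subset[OF cont sub])
  then have "set_integrable lborel {min 0 s<..<max 0 s} h"
    by (rule set_integrable_subset) auto
  then show ?thesis
    by (auto simp: interval_lebesgue_integrable_def zero_ereal_def min_def max_def split: if_splits)
qed

section \<open>Smoothness of the frame and the invariants\<close>

lemma ruled_surface_has_derivs:
  assumes "is_ruled_surface \<phi>" "s \<in> param_dom \<phi>"
  shows "(director \<phi> has_vector_derivative frame_t \<phi> s) (at s within param_dom \<phi>)"
    and "(frame_t \<phi> has_vector_derivative surf_deriv \<phi> (frame_t \<phi>) s) (at s within param_dom \<phi>)"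
    and "(striction \<phi> has_vector_derivative surf_deriv \<phi> (striction \<phi>) s) (at s within param_dom \<phi>)"
proof -
  let ?I = "param_dom \<phi>"
  have "((curve_deriv ?I ^^ n) (director \<phi>)) differentiable_on ?I"
    "((curve_deriv ?I ^^ n) (striction \<phi>)) differentiable_on ?I" for n
    using assms(1) unfolding is_ruled_surface_def smooth_curve_on_def by blast+
  from this(1)[of 0] this(1)[of 1] this(2)[of 0]
  show "(director \<phi> has_vector_derivative frame_t \<phi> s) (at s within ?I)"
    "(frame_t \<phi> has_vector_derivative surf_deriv \<phi> (frame_t \<phi>) s) (at s within ?I)"
    "(striction \<phi> has_vector_derivative surf_deriv \<phi> (striction \<phi>) s) (at s within ?I)"
    using assms(2)
    by (simp_all add: differentiable_on_def vector_derivative_works frame_t_def surf_deriv_def)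
qed

lemma continuous_on_conical_curvature:
  assumes "is_ruled_surface \<phi>"
  shows "continuous_on (param_dom \<phi>) (conical_curvature \<phi>)"
proof -
  let ?I = "param_dom \<phi>"
  have sm: "((curve_deriv ?I ^^ n) (director \<phi>)) differentiable_on ?I" for n
    using assms unfolding is_ruled_surface_def smooth_curve_on_def by blast
  have c: "continuous_on ?I (director \<phi>)" "continuous_on ?I (frame_t \<phi>)"
    "continuous_on ?I (surf_deriv \<phi> (frame_t \<phi>))"
    using sm[of 0] sm[of 1] sm[of 2]
    by (auto simp: frame_t_def surf_deriv_def numeral_2_eq_2 intro: differentiable_imp_continuous_on)
  have "continuous_on ?I (frame_g \<phi>)"
    using bounded_bilinear.continuous_on[OF bounded_bilinear_cross3 c(1,2)]
    by (simp add: frame_g_def[abs_def])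
  then have "continuous_on ?I (\<lambda>s. surf_deriv \<phi> (frame_t \<phi>) s \<bullet> frame_g \<phi> s)"
    by (intro continuous_on_inner c)
  then show ?thesis
    using darboux_equations(3)[OF assms] by (simp cong: continuous_on_cong)
qed

lemma continuous_on_delta_inv:
  assumes "is_ruled_surface \<phi>"
  shows "continuous_on (param_dom \<phi>) (delta_inv \<phi>)"
proof -
  let ?I = "param_dom \<phi>"
  have sm: "((curve_deriv ?I ^^ n) (director \<phi>)) differentiable_on ?I"
    "((curve_deriv ?I ^^ n) (striction \<phi>)) differentiable_on ?I" for n
    using assms unfolding is_ruled_surface_def smooth_curve_on_def by blast+
  have "continuous_on ?I (director \<phi>)" "continuous_on ?I (surf_deriv \<phi> (striction \<phi>))"
    using sm(1)[of 0] sm(2)[of 1]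
    by (auto simp: surf_deriv_def intro: differentiable_imp_continuous_on)
  then show ?thesis
    unfolding delta_inv_def[abs_def] by (intro continuous_on_inner)
qed

lemma Delta_inv_eq_inner: "Delta_inv \<phi> s = surf_deriv \<phi> (striction \<phi>) s \<bullet> frame_g \<phi> s"
  by (simp add: Delta_inv_def frame_g_def dot_cross_det)

lemma frame_g_inner:
  assumes "is_ruled_surface \<phi>" "s \<in> param_dom \<phi>"
  shows "director \<phi> s \<bullet> frame_g \<phi> s = 0" "frame_t \<phi> s \<bullet> frame_g \<phi> s = 0"
    "frame_g \<phi> s \<bullet> frame_g \<phi> s = 1"
  using orthonormal_expansion(2)[OF frame_orthonormal[OF assms]]
  by (simp_all add: frame_g_def dot_cross_self)

section \<open>Geometry of a Bertrand offset\<close>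

locale bertrand_pair =
  fixes \<phi> \<phi>\<^sub>1 :: ruled_surface and \<sigma> \<theta> \<theta>' :: "real \<Rightarrow> real"
  assumes surf: "is_ruled_surface \<phi>" and surf1: "is_ruled_surface \<phi>\<^sub>1"
    and offset: "bertrand_offset \<phi> \<phi>\<^sub>1 \<sigma>"
    and angle: "is_offset_angle \<phi> \<phi>\<^sub>1 \<sigma> \<theta> \<theta>'"
begin

lemma image_param_dom: "\<sigma> ` param_dom \<phi> = param_dom \<phi>\<^sub>1"
  using offset by (simp add: bertrand_offset_def bij_betw_def)

lemma convex_param_dom: "convex (param_dom \<phi>)"
  using surf is_interval_convex by (auto simp: is_ruled_surface_def)

lemma frame_relation:
  assumes "s \<in> param_dom \<phi>"
  shows "director \<phi>\<^sub>1 (\<sigma> s) = cos (\<theta> s) *\<^sub>R director \<phi> s - sin (\<theta> s) *\<^sub>R frame_g \<phi> s"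
    and "frame_t \<phi>\<^sub>1 (\<sigma> s) = frame_t \<phi> s"
    and "frame_g \<phi>\<^sub>1 (\<sigma> s) = sin (\<theta> s) *\<^sub>R director \<phi> s + cos (\<theta> s) *\<^sub>R frame_g \<phi> s"
  using assms offset angle
  by (auto simp: bertrand_offset_def is_offset_angle_def dual_t_def dual_e_def dual_g_def
      dual_cos_eq dual_sin_eq dual_scale_def)

text \<open>Comparing the moments of the common line \<open>t\<close> puts \<open>c\<^sub>1 - c\<close> on that line; comparing the
  moments of the rulings then measures it, because \<open>t \<times> e\<^sub>1 = - g\<^sub>1\<close>.\<close>

lemma striction_offset:
  assumes s: "s \<in> param_dom \<phi>"
  shows "striction \<phi>\<^sub>1 (\<sigma> s) = striction \<phi> s + \<theta>' s *\<^sub>R frame_t \<phi> s"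
proof -
  let ?t = "frame_t \<phi> s" and ?e1 = "director \<phi>\<^sub>1 (\<sigma> s)" and ?g1 = "frame_g \<phi>\<^sub>1 (\<sigma> s)"
  define d where "d = striction \<phi>\<^sub>1 (\<sigma> s) - striction \<phi> s"
  have s1: "\<sigma> s \<in> param_dom \<phi>\<^sub>1" using image_param_dom s by blast
  have tt: "?t \<bullet> ?t = 1" using frame_orthonormal[OF surf s] by simp
  have "snd (dual_t \<phi>\<^sub>1 (\<sigma> s)) = snd (dual_t \<phi> s)"
    using offset s by (simp add: bertrand_offset_def)
  then have "d \<times> ?t = 0"
    by (simp add: dual_t_def d_def frame_relation[OF s] Cross3.left_diff_distrib)
  then have "?t \<times> (d \<times> ?t) = 0" by simp
  then have d: "d = (d \<bullet> ?t) *\<^sub>R ?t"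
    by (simp add: Lagrange tt inner_commute)
  have "snd (dual_e \<phi>\<^sub>1 (\<sigma> s)) = snd (dual_cos (\<theta> s, \<theta>' s) *\<^sub>D dual_e \<phi> s
      - dual_sin (\<theta> s, \<theta>' s) *\<^sub>D dual_g \<phi> s)"
    using angle s by (simp add: is_offset_angle_def)
  then have "striction \<phi>\<^sub>1 (\<sigma> s) \<times> ?e1 = striction \<phi> s \<times> ?e1 - \<theta>' s *\<^sub>R ?g1"
    by (simp add: dual_e_def dual_g_def dual_scale_def dual_cos_eq dual_sin_eq frame_relation[OF s]
        Cross3.right_diff_distrib cross_mult_right algebra_simps)
  then have "d \<times> ?e1 = - \<theta>' s *\<^sub>R ?g1"
    by (simp add: d_def Cross3.left_diff_distrib)
  moreover have "d \<times> ?e1 = - (d \<bullet> ?t) *\<^sub>R ?g1"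
  proof -
    have "?t \<times> ?e1 = - ?g1"
      by (metis cross_skew frame_g_def frame_relation(2)[OF s])
    then show ?thesis by (subst d) (simp add: cross_mult_left)
  qed
  moreover have "?g1 \<noteq> 0" using frame_g_inner(3)[OF surf1 s1] by auto
  ultimately have "d \<bullet> ?t = \<theta>' s" by auto
  then show ?thesis using d by (simp add: d_def algebra_simps)
qed

lemma has_derivs_along:
  assumes s: "s \<in> param_dom \<phi>"
  obtains d where "d \<noteq> 0"
    "((\<lambda>u. director \<phi>\<^sub>1 (\<sigma> u)) has_vector_derivative d *\<^sub>R frame_t \<phi> s) (at s within param_dom \<phi>)"
    "((\<lambda>u. striction \<phi>\<^sub>1 (\<sigma> u)) has_vector_derivative d *\<^sub>R surf_deriv \<phi>\<^sub>1 (striction \<phi>\<^sub>1) (\<sigma> s))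
       (at s within param_dom \<phi>)"
proof -
  have s1: "\<sigma> s \<in> param_dom \<phi>\<^sub>1" using image_param_dom s by blast
  obtain d where d: "d \<noteq> 0" "(\<sigma> has_vector_derivative d) (at s within param_dom \<phi>)"
    using offset s by (auto simp: bertrand_offset_def has_real_derivative_iff_has_vector_derivative)
  note D1 = ruled_surface_has_derivs[OF surf1 s1, folded image_param_dom]
  show ?thesis
    using that[OF d(1)] vector_diff_chain_within[OF d(2) D1(1)] vector_diff_chain_within[OF d(2) D1(3)]
    by (simp add: o_def frame_relation(2)[OF s])
qed

text \<open>In \<open>(e\<^sub>1 \<bullet> e)' = (ds\<^sub>1/ds) t\<^sub>1 \<bullet> e + e\<^sub>1 \<bullet> t\<close> both terms vanish because \<open>t\<^sub>1 = t\<close>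
  is orthogonal to \<open>e\<close> and to \<open>e\<^sub>1\<close>. Since \<open>cos\<close> is injective on \<open>[0, \<pi>]\<close>, the
  angle itself is constant.\<close>

lemma offset_angle_constant:
  assumes "s \<in> param_dom \<phi>" "r \<in> param_dom \<phi>"
  shows "\<theta> s = \<theta> r"
proof -
  let ?I = "param_dom \<phi>"
  have deriv: "((\<lambda>u. cos (\<theta> u)) has_vector_derivative 0) (at s within ?I)" if s: "s \<in> ?I" for s
  proof -
    have s1: "\<sigma> s \<in> param_dom \<phi>\<^sub>1" using image_param_dom s by blast
    obtain d where "((\<lambda>u. director \<phi>\<^sub>1 (\<sigma> u)) has_vector_derivative d *\<^sub>R frame_t \<phi> s) (at s within ?I)"
      using has_derivs_along[OF s] by metis
    from bounded_bilinear.has_vector_derivative[OF bounded_bilinear_inner this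
        ruled_surface_has_derivs(1)[OF surf s]]
    have D: "((\<lambda>u. director \<phi>\<^sub>1 (\<sigma> u) \<bullet> director \<phi> u) has_vector_derivative 0) (at s within ?I)"
      using frame_orthonormal(3)[OF surf s] frame_orthonormal(3)[OF surf1 s1]
      by (simp add: frame_relation(2)[OF s] inner_commute)
    have eq: "cos (\<theta> u) = director \<phi>\<^sub>1 (\<sigma> u) \<bullet> director \<phi> u" if "u \<in> ?I" for u
      using frame_orthonormal(1)[OF surf that] frame_g_inner(1)[OF surf that]
      by (simp add: frame_relation(1)[OF that] inner_diff_left inner_commute[of "frame_g \<phi> u"])
    show ?thesis
      by (rule has_vector_derivative_transform[OF s eq D])
  qed
  have "cos (\<theta> s) = cos (\<theta> r)"
    by (rule has_vector_derivative_zero_constant[OF convex_param_dom deriv]) (simp_all add: assms)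
  moreover have "0 \<le> \<theta> s" "\<theta> s \<le> pi" "0 \<le> \<theta> r" "\<theta> r \<le> pi"
    using angle assms by (simp_all add: is_offset_angle_def)
  ultimately show ?thesis using cos_inj_pi by blast
qed

text \<open>The striction conditions of the two surfaces say that \<open>c'\<close> and \<open>c\<^sub>1'\<close> are orthogonal to the
  common vector \<open>t\<close>, and \<open>c\<^sub>1 - c = \<theta>' t\<close> is orthogonal to \<open>t'\<close>; so
  \<open>(c\<^sub>1 - c) \<bullet> t\<close> has derivative zero.\<close>

lemma offset_distance_constant:
  assumes "s \<in> param_dom \<phi>" "r \<in> param_dom \<phi>"
  shows "\<theta>' s = \<theta>' r"
proof -
  let ?I = "param_dom \<phi>"
  have deriv: "(\<theta>' has_vector_derivative 0) (at s within ?I)" if s: "s \<in> ?I" for s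
  proof -
    let ?c' = "surf_deriv \<phi> (striction \<phi>) s" and ?c1' = "surf_deriv \<phi>\<^sub>1 (striction \<phi>\<^sub>1) (\<sigma> s)"
    let ?t = "frame_t \<phi> s" and ?t' = "surf_deriv \<phi> (frame_t \<phi>) s"
    have s1: "\<sigma> s \<in> param_dom \<phi>\<^sub>1" using image_param_dom s by blast
    obtain d where "((\<lambda>u. striction \<phi>\<^sub>1 (\<sigma> u)) has_vector_derivative d *\<^sub>R ?c1') (at s within ?I)"
      using has_derivs_along[OF s] by metis
    from bounded_bilinear.has_vector_derivative[OF bounded_bilinear_inner
        has_vector_derivative_diff[OF this ruled_surface_has_derivs(3)[OF surf s]]
        ruled_surface_has_derivs(2)[OF surf s]]
    have "((\<lambda>u. (striction \<phi>\<^sub>1 (\<sigma> u) - striction \<phi> u) \<bullet> frame_t \<phi> u) has_vector_derivative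
        ((striction \<phi>\<^sub>1 (\<sigma> s) - striction \<phi> s) \<bullet> ?t' + (d *\<^sub>R ?c1' - ?c') \<bullet> ?t)) (at s within ?I)" .
    moreover have "?c' \<bullet> ?t = 0"
      using surf s by (simp add: is_ruled_surface_def frame_t_def)
    moreover have "?c1' \<bullet> ?t = 0"
      using surf1 s1 unfolding frame_relation(2)[OF s, symmetric]
      by (simp add: is_ruled_surface_def frame_t_def)
    moreover have "?t \<bullet> ?t' = 0"
      using frame_orthonormal[OF surf s] frame_g_inner[OF surf s]
      by (simp add: darboux_equations(1)[OF surf s] inner_diff_right inner_commute)
    ultimately have D: "((\<lambda>u. (striction \<phi>\<^sub>1 (\<sigma> u) - striction \<phi> u) \<bullet> frame_t \<phi> u)
        has_vector_derivative 0) (at s within ?I)"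
      by (simp add: striction_offset[OF s] inner_diff_left)
    have eq: "\<theta>' u = (striction \<phi>\<^sub>1 (\<sigma> u) - striction \<phi> u) \<bullet> frame_t \<phi> u" if "u \<in> ?I" for u
      using frame_orthonormal(2)[OF surf that] by (simp add: striction_offset[OF that])
    show ?thesis
      by (rule has_vector_derivative_transform[OF s eq D])
  qed
  show ?thesis
    by (rule has_vector_derivative_zero_constant[OF convex_param_dom deriv]) (simp_all add: assms)
qed

text \<open>The right-hand side is the \<open>g\<^sub>1\<close>-component of the derivative of \<open>c\<^sub>1 = c + \<theta>' t\<close> with
  respect to \<open>s\<close>. It equals \<open>(ds\<^sub>1/ds) \<Delta>\<^sub>1\<close>, where the factor \<open>ds\<^sub>1/ds\<close> is not zero.\<close>

lemma Delta_inv_offset_zero_iff: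
  assumes s: "s \<in> param_dom \<phi>"
  shows "Delta_inv \<phi>\<^sub>1 (\<sigma> s) = 0 \<longleftrightarrow>
    delta_inv \<phi> s * sin (\<theta> s) + Delta_inv \<phi> s * cos (\<theta> s)
      + \<theta>' s * (conical_curvature \<phi> s * cos (\<theta> s) - sin (\<theta> s)) = 0"
proof -
  let ?I = "param_dom \<phi>"
  let ?c' = "surf_deriv \<phi> (striction \<phi>) s" and ?c1' = "surf_deriv \<phi>\<^sub>1 (striction \<phi>\<^sub>1) (\<sigma> s)"
  let ?t' = "surf_deriv \<phi> (frame_t \<phi>) s"
  obtain d where d: "d \<noteq> 0"
    "((\<lambda>u. striction \<phi>\<^sub>1 (\<sigma> u)) has_vector_derivative d *\<^sub>R ?c1') (at s within ?I)"
    using has_derivs_along[OF s] by metis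
  \<comment> \<open>The offset distance is constant, so its value at \<open>s\<close> may be used at every \<open>u\<close>.\<close>
  have "((\<lambda>u. striction \<phi> u + \<theta>' s *\<^sub>R frame_t \<phi> u) has_vector_derivative ?c' + \<theta>' s *\<^sub>R ?t')
      (at s within ?I)"
    using has_vector_derivative_add[OF ruled_surface_has_derivs(3)[OF surf s]
        bounded_linear.has_vector_derivative[OF bounded_linear_scaleR_right
          ruled_surface_has_derivs(2)[OF surf s]]] .
  moreover have "striction \<phi>\<^sub>1 (\<sigma> u) = striction \<phi> u + \<theta>' s *\<^sub>R frame_t \<phi> u" if "u \<in> ?I" for u
    by (simp add: striction_offset[OF that] offset_distance_constant[OF that s])
  ultimately have "((\<lambda>u. striction \<phi>\<^sub>1 (\<sigma> u)) has_vector_derivative ?c' + \<theta>' s *\<^sub>R ?t')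
      (at s within ?I)"
    by (rule has_vector_derivative_transform[OF s, rotated])
  then have "d *\<^sub>R ?c1' = ?c' + \<theta>' s *\<^sub>R ?t'"
    using vector_derivative_unique_within[OF param_dom_not_bot[OF surf s] d(2)] by blast
  then have "d * Delta_inv \<phi>\<^sub>1 (\<sigma> s) = (?c' + \<theta>' s *\<^sub>R ?t') \<bullet> frame_g \<phi>\<^sub>1 (\<sigma> s)"
    by (metis Delta_inv_eq_inner inner_scaleR_left)
  also have "\<dots> = delta_inv \<phi> s * sin (\<theta> s) + Delta_inv \<phi> s * cos (\<theta> s)
      + \<theta>' s * (conical_curvature \<phi> s * cos (\<theta> s) - sin (\<theta> s))"
    using frame_orthonormal[OF surf s] frame_g_inner[OF surf s]
    by (simp add: frame_relation(3)[OF s] darboux_equations(1)[OF surf s] Delta_inv_eq_inner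
        delta_inv_def inner_add_left inner_add_right inner_diff_left inner_commute algebra_simps)
  finally show ?thesis using d(1) by (metis mult_eq_0_iff)
qed

end

section \<open>The integral criterion\<close>

theorem corollary4p1:
  fixes \<phi> \<phi>\<^sub>1 :: ruled_surface
    and \<sigma> \<theta> \<theta>' :: "real \<Rightarrow> real"
  assumes "is_ruled_surface \<phi>" and "is_ruled_surface \<phi>\<^sub>1"
    and "0 \<in> param_dom \<phi>"
    and "bertrand_offset \<phi> \<phi>\<^sub>1 \<sigma>"
    and "is_offset_angle \<phi> \<phi>\<^sub>1 \<sigma> \<theta> \<theta>'"
    and "developable \<phi>"
  shows "developable \<phi>\<^sub>1 \<longleftrightarrow>
    (\<forall>s\<in>param_dom \<phi>.
       (LBINT u=0..s. conical_curvature_star \<phi> u) * sin (\<theta> s)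
       + \<theta>' s * ((LBINT u=0..s. conical_curvature \<phi> u) * cos (\<theta> s) - s * sin (\<theta> s)) = 0)"
proof -
  interpret bertrand_pair \<phi> \<phi>\<^sub>1 \<sigma> \<theta> \<theta>'
    using assms by unfold_locales
  let ?I = "param_dom \<phi>" and ?\<gamma> = "conical_curvature \<phi>" and ?\<gamma>s = "conical_curvature_star \<phi>"
  have I: "is_interval ?I" "interior ?I \<noteq> {}" using surf by (auto simp: is_ruled_surface_def)
  define T where "T = \<theta> 0"
  define T' where "T' = \<theta>' 0"
  have const: "\<theta> s = T" "\<theta>' s = T'" if "s \<in> ?I" for s
    using offset_angle_constant[OF that assms(3)] offset_distance_constant[OF that assms(3)]
    by (auto simp: T_def T'_def)
  have dev: "Delta_inv \<phi> s = 0" if "s \<in> ?I" for s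
    using assms(6) that by (simp add: developable_def)
  then have star: "?\<gamma>s s = delta_inv \<phi> s" if "s \<in> ?I" for s
    using that by (simp add: conical_curvature_star_def dual_conical_curvature_def)
  have cs: "continuous_on ?I ?\<gamma>s"
    using continuous_on_delta_inv[OF surf] star by (simp cong: continuous_on_cong)
  note cg = continuous_on_conical_curvature[OF surf]
  define h where "h u = ?\<gamma>s u * sin T + (T' * cos T) * ?\<gamma> u - T' * sin T" for u
  have ch: "continuous_on ?I h"
    unfolding h_def by (intro continuous_intros cs cg)
  have int: "(LBINT u=0..s. h u) = (LBINT u=0..s. ?\<gamma>s u) * sin (\<theta> s)
      + \<theta>' s * ((LBINT u=0..s. ?\<gamma> u) * cos (\<theta> s) - s * sin (\<theta> s))" if s: "s \<in> ?I" for s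
  proof -
    note integrable = interval_integrable_continuous_from_zero[OF I(1) assms(3) s]
    have c1: "(LBINT u=0..s. T' * sin T) = T' * sin T * s"
      unfolding zero_ereal_def interval_integral_const(2) by simp
    have "(LBINT u=0..s. h u) = (LBINT u=0..s. ?\<gamma>s u * sin T + (T' * cos T) * ?\<gamma> u) - (LBINT u=0..s. T' * sin T)"
      unfolding h_def
      by (intro interval_lebesgue_integral_diff(2) integrable continuous_intros cs cg)
    also have "(LBINT u=0..s. ?\<gamma>s u * sin T + (T' * cos T) * ?\<gamma> u)
        = (LBINT u=0..s. ?\<gamma>s u * sin T) + (LBINT u=0..s. (T' * cos T) * ?\<gamma> u)"
      by (intro interval_lebesgue_integral_add(2) integrable continuous_intros cs cg)
    finally show ?thesis unfolding c1 by (simp add: const[OF s] algebra_simps)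
  qed
  have "developable \<phi>\<^sub>1 \<longleftrightarrow> (\<forall>s\<in>?I. Delta_inv \<phi>\<^sub>1 (\<sigma> s) = 0)"
    by (auto simp: developable_def simp flip: image_param_dom)
  also have "\<dots> \<longleftrightarrow> (\<forall>s\<in>?I. h s = 0)"
    by (intro ball_cong refl)
       (simp add: Delta_inv_offset_zero_iff dev star const h_def algebra_simps)
  also have "\<dots> \<longleftrightarrow> (\<forall>s\<in>?I. (LBINT u=0..s. h u) = 0)"
    using interval_integral_zero_iff[OF I assms(3) ch] by simp
  finally show ?thesis using int by simp
qed

end
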